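(* For every positive integer $m$ there exists a palindromic graph on $8m$ vertices having no vertex of degree $1$.
   Context: All graphs are finite, simple and undirected. For a graph $G$ on $n$ vertices with adjacency matrix $A_G$, its characteristic polynomial is $\chi_G(\lambda)=\det(\lambda I-A_G)=a_0\lambda^n+a_1\lambda^{n-1}+\dots+a_n$. $G$ is palindromic if $a_i=a_{n-i}$ for all $i=0,\dots,n$. A graph with no vertex of degree $1$ is called bald. *)

theory Defs
  imports "Jordan_Normal_Form.Char_Poly" "Graph_Theory.Pair_Digraph"
begin

text \<open>
  A finite simple undirected graph is a \<^locale>\<open>pair_graph\<close>: finite, without loops or parallel
  arcs, and with a symmetric arc relation, so that an edge is a pair of opposite arcs.
\<close>

text \<open>
  The vertices are listed in increasing order to index rows and columns. Another ordering
  conjugates the matrix by a permutation matrix and so has the same characteristic polynomial.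
\<close>
definition adjacency_matrix :: "('a::linorder) pair_pre_digraph \<Rightarrow> int mat" where
  "adjacency_matrix G =
     (let vs = sorted_list_of_set (pverts G); n = card (pverts G)
      in mat n n (\<lambda>(i, j). if (vs ! i, vs ! j) \<in> parcs G then 1 else 0))"

definition graph_char_poly :: "('a::linorder) pair_pre_digraph \<Rightarrow> int poly" where
  "graph_char_poly G = char_poly (adjacency_matrix G)"

text \<open>The coefficients are numbered from the top: the \<open>i\<close>-th one belongs to the power \<open>n - i\<close>.\<close>
definition graph_char_coeff :: "('a::linorder) pair_pre_digraph \<Rightarrow> nat \<Rightarrow> int" where
  "graph_char_coeff G i = coeff (graph_char_poly G) (card (pverts G) - i)"

definition palindromic :: "('a::linorder) pair_pre_digraph \<Rightarrow> bool" where
  "palindromic G \<longleftrightarrow>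
     (\<forall>i \<le> card (pverts G). graph_char_coeff G i = graph_char_coeff G (card (pverts G) - i))"

text \<open>In a symmetric digraph without parallel arcs the out-degree is the number of neighbours.\<close>
definition bald :: "'a pair_pre_digraph \<Rightarrow> bool" where
  "bald G \<longleftrightarrow> (\<forall>v \<in> pverts G. out_degree (with_proj G) v \<noteq> 1)"

end

theory Submission
  imports Defs
begin

text \<open>
  The characteristic polynomial of a disjoint union is the product of the characteristic
  polynomials, and self-reciprocal polynomials are closed under products. Hence it suffices to find
  one palindromic graph on eight vertices with all degrees at least two, and to take \<open>m\<close> disjoint
  copies of it. Such a graph exists even among the bipartite graphs with biadjacency matrix \<open>B\<close> of
  size four, where the characteristic polynomial is the determinant of \<open>\<lambda>\<^sup>2 I - B B\<^sup>T\<close>. The matrix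
  \<open>B\<close> below was found by exhaustive search.
\<close>

lemma char_poly_block_diag:
  fixes A B :: "'a :: idom mat"
  assumes A: "A \<in> carrier_mat n n" and B: "B \<in> carrier_mat k k"
  shows "char_poly (four_block_mat A (0\<^sub>m n k) (0\<^sub>m k n) B) = char_poly A * char_poly B"
proof -
  have "char_poly_matrix (four_block_mat A (0\<^sub>m n k) (0\<^sub>m k n) B)
    = four_block_mat (char_poly_matrix A) (0\<^sub>m n k) (0\<^sub>m k n) (char_poly_matrix B)"
    using A B by (intro eq_matI) (auto simp: char_poly_matrix_def)
  then show ?thesis
    using A B unfolding char_poly_def
    by (simp add: det_four_block_mat_upper_right_zero[of _ n _ k])
qed

text \<open>The diagonal blocks of the characteristic matrix are x times the identity, which
  commutes with every block. The block determinant formula then gives the determinant of x^2 I - BC,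
  the characteristic matrix of BC with x^2 put for x.\<close>

lemma char_poly_bipartite:
  fixes B C :: "'a :: idom mat"
  assumes B: "B \<in> carrier_mat n n" and C: "C \<in> carrier_mat n n"
  shows "char_poly (four_block_mat (0\<^sub>m n n) B C (0\<^sub>m n n)) = char_poly (B * C) \<circ>\<^sub>p monom 1 2"
proof -
  \<comment> \<open>Being a ring homomorphism, the substitution of x^2 for x can be pulled out of
    the determinant.\<close>
  have hom: "comm_ring_hom (\<lambda>p. p \<circ>\<^sub>p monom (1::'a) 2)"
    by unfold_locales (auto simp: pcompose_add pcompose_mult)
  let ?c = "map_mat (\<lambda>a. [:-a:])"
  have cm: "char_poly_matrix (four_block_mat (0\<^sub>m n n) B C (0\<^sub>m n n))
    = four_block_mat ([:0,1:] \<cdot>\<^sub>m 1\<^sub>m n) (?c B) (?c C) ([:0,1:] \<cdot>\<^sub>m 1\<^sub>m n)"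
    using B C by (intro eq_matI) (auto simp: char_poly_matrix_def)
  \<comment> \<open>An entry of \<open>?c B * ?c C\<close> is a sum of constant polynomials, whereas
    \<open>B * C\<close> sums first and embeds afterwards.\<close>
  have sum_to_poly: "(\<Sum>i\<in>I. [:f i:]) = [:\<Sum>i\<in>I. f i:]" for I and f :: "nat \<Rightarrow> 'a"
    by (induction I rule: infinite_finite_induct) auto
  have com: "?c C * ([:0,1:] \<cdot>\<^sub>m 1\<^sub>m n) = ([:0,1:] \<cdot>\<^sub>m 1\<^sub>m n) * ?c C"
    using C by (simp add: mult_smult_distrib[of _ n n _ n] mult_smult_assoc_mat[of _ n n _ n])
  have prod: "([:0,1:] \<cdot>\<^sub>m 1\<^sub>m n) * ([:0,1:] \<cdot>\<^sub>m 1\<^sub>m n) - ?c B * ?c C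
    = map_mat (\<lambda>p. p \<circ>\<^sub>p monom 1 2) (char_poly_matrix (B * C))"
    using B C
    by (intro eq_matI)
      (auto simp: char_poly_matrix_def mult_smult_distrib[of _ n n _ n]
        mult_smult_assoc_mat[of _ n n _ n] scalar_prod_def monom_altdef power2_eq_square
        pcompose_pCons sum_to_poly mult.commute simp flip: minus_pCons)
  show ?thesis
    unfolding char_poly_def cm
    using det_four_block_mat[OF _ _ _ _ com, where A = "[:0,1:] \<cdot>\<^sub>m 1\<^sub>m n" and B = "?c B"] B C
    by (simp add: prod comm_ring_hom.hom_det[OF hom])
qed

lemma adjacency_matrix_lessThan:
  assumes "pverts G = {..<n}"
  shows "adjacency_matrix G = mat n n (\<lambda>(i, j). if (i, j) \<in> parcs G then 1 else 0)"
proof -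
  have "sorted_list_of_set {..<n} = [0..<n]"
    by (metis atLeast0LessThan sorted_list_of_set_range)
  then show ?thesis
    by (intro eq_matI) (simp_all add: adjacency_matrix_def Let_def assms)
qed

text \<open>\<open>reflect_poly\<close> reverses at the actual degree. A characteristic polynomial
  is monic of degree n, so this agrees with reversing at n. The new form is multiplicative and hence
  survives taking powers.\<close>

lemma palindromic_iff_reflect_poly:
  "palindromic G \<longleftrightarrow> reflect_poly (graph_char_poly G) = graph_char_poly G"
proof -
  let ?p = "graph_char_poly G" and ?n = "card (pverts G)"
  have deg: "degree ?p = ?n"
    unfolding graph_char_poly_def
    by (rule conjunct1[OF degree_monic_char_poly]) (auto simp: adjacency_matrix_def Let_def)
  have "palindromic G \<longleftrightarrow> (\<forall>i \<le> ?n. coeff ?p (?n - i) = coeff ?p i)"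
    by (simp add: palindromic_def graph_char_coeff_def)
  also have "\<dots> \<longleftrightarrow> reflect_poly ?p = ?p"
    by (auto simp: poly_eq_iff coeff_reflect_poly deg coeff_eq_0 not_le)
  finally show ?thesis .
qed

text \<open>Vertex u is vertex \<open>u mod k\<close> of copy \<open>u div k\<close>. Each copy is
  an interval, so the increasing order of the vertices makes the adjacency matrix block
  diagonal.\<close>

definition disjoint_copies :: "nat \<Rightarrow> nat \<Rightarrow> nat pair_pre_digraph \<Rightarrow> nat pair_pre_digraph" where
  "disjoint_copies k m G =
    \<lparr>pverts = {..<k * m},
     parcs = {(u, v). u < k * m \<and> v < k * m \<and> u div k = v div k \<and>
       (u mod k, v mod k) \<in> parcs G}\<rparr>"

lemma pverts_disjoint_copies [simp]: "pverts (disjoint_copies k m G) = {..<k * m}"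
  by (simp add: disjoint_copies_def)

lemma parcs_disjoint_copies:
  "(u, v) \<in> parcs (disjoint_copies k m G) \<longleftrightarrow>
    u < k * m \<and> v < k * m \<and> u div k = v div k \<and> (u mod k, v mod k) \<in> parcs G"
  by (simp add: disjoint_copies_def)

lemma pair_graph_disjoint_copies:
  assumes "pair_graph G"
  shows "pair_graph (disjoint_copies k m G)"
proof -
  interpret pair_graph G by fact
  let ?H = "disjoint_copies k m G"
  have sub: "parcs ?H \<subseteq> {..<k * m} \<times> {..<k * m}"
    by (auto simp: parcs_disjoint_copies)
  then have "finite (parcs ?H)"
    by (rule finite_subset) simp
  moreover have "symmetric (with_proj ?H)"
    using arcs_symmetric
    by (auto simp: symmetric_def arcs_ends_def arc_to_ends_def sym_def parcs_disjoint_copies)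
  moreover have "fst e \<noteq> snd e" if "e \<in> parcs ?H" for e
    using that no_loops[of "(fst e mod k, snd e mod k)"]
    by (cases e) (auto simp: parcs_disjoint_copies)
  ultimately show ?thesis
    using sub by unfold_locales auto
qed

lemma bald_disjoint_copies:
  assumes verts: "pverts G = {..<k}" and G: "pair_graph G" and bald: "bald G"
  shows "bald (disjoint_copies k m G)"
  unfolding bald_def
proof
  interpret pair_graph G by fact
  fix v assume "v \<in> pverts (disjoint_copies k m G)"
  then have v: "v < k * m" by simp
  then have k: "k > 0" by (cases k) auto
  have q: "v div k < m"
    using v by (simp add: less_mult_imp_div_less mult.commute)
  have lt: "k * (v div k) + w < k * m" if "w < k" for w
  proof -
    have "k * (v div k) + w < k * (v div k + 1)" using that by simp
    also have "\<dots> \<le> k * m" using q by (intro mult_le_mono2) simp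
    finally show ?thesis .
  qed
  \<comment> \<open>The heads are shifted into the copy that contains v. Dropping the tail is
    injective here, since all arcs in \<open>?R\<close> start at \<open>v mod k\<close>.\<close>
  have "out_arcs (with_proj (disjoint_copies k m G)) v
    = (\<lambda>e. (v, k * (v div k) + snd e)) ` out_arcs (with_proj G) (v mod k)" (is "?L = ?f ` ?R")
  proof (intro equalityI subsetI)
    fix e assume "e \<in> ?L"
    then obtain w where e: "e = (v, w)" "v div k = w div k" "(v mod k, w mod k) \<in> parcs G"
      by (cases e) (auto simp: parcs_disjoint_copies)
    then have "e = ?f (v mod k, w mod k)" by simp
    with e show "e \<in> ?f ` ?R" by (intro image_eqI[where x = "(v mod k, w mod k)"]) auto
  next
    fix e assume "e \<in> ?f ` ?R"
    then obtain w where e: "e = (v, k * (v div k) + w)" "(v mod k, w) \<in> parcs G" by auto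
    then have "w < k" using verts in_arcsD2 by auto
    with e v lt[of w] show "e \<in> ?L" by (auto simp: parcs_disjoint_copies)
  qed
  moreover have "inj_on ?f ?R" by (auto simp: inj_on_def)
  ultimately have "out_degree (with_proj (disjoint_copies k m G)) v
    = out_degree (with_proj G) (v mod k)"
    by (simp add: out_degree_def card_image)
  then show "out_degree (with_proj (disjoint_copies k m G)) v \<noteq> 1"
    using bald k verts by (simp add: bald_def)
qed

lemma graph_char_poly_disjoint_copies:
  assumes verts: "pverts G = {..<k}"
  shows "graph_char_poly (disjoint_copies k m G) = graph_char_poly G ^ m"
proof (induction m)
  case 0
  show ?case
    by (simp add: graph_char_poly_def adjacency_matrix_def char_poly_def)
next
  case (Suc m)
  let ?A = "adjacency_matrix G"
  let ?C = "\<lambda>m. adjacency_matrix (disjoint_copies k m G)"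
  note adj = adjacency_matrix_lessThan[OF verts]
    adjacency_matrix_lessThan[OF pverts_disjoint_copies]
  \<comment> \<open>Copy 0 is split off at the front: an index i beyond it plays the role of
    \<open>i - k\<close> among the remaining m copies.\<close>
  have shift: "i div k = Suc ((i - k) div k)" "(i - k) mod k = i mod k" if "\<not> i < k" "k > 0" for i
    using that by (simp_all add: le_div_geq le_mod_geq)
  have "?C (Suc m) = four_block_mat ?A (0\<^sub>m k (k * m)) (0\<^sub>m (k * m) k) (?C m)"
  proof (cases "k = 0")
    case False
    then show ?thesis
      by (intro eq_matI) (auto simp: adj parcs_disjoint_copies shift)
  qed (auto simp: adj)
  moreover have "?A \<in> carrier_mat k k" "?C m \<in> carrier_mat (k * m) (k * m)"
    by (simp_all add: adj)
  ultimately show ?case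
    using Suc.IH by (simp add: graph_char_poly_def char_poly_block_diag)
qed

definition bald8_biadjacency :: "int mat" where
  "bald8_biadjacency =
     mat 4 4 (\<lambda>(i, j). [[1,1,0,0], [1,1,1,0], [0,0,1,1], [1,0,1,1]] ! i ! j)"

lemma bald8_biadjacency_carrier [simp]: "bald8_biadjacency \<in> carrier_mat 4 4"
  by (simp add: bald8_biadjacency_def)

text \<open>Vertices 0 to 3 stand for the rows and 4 to 7 for the columns of
  \<open>bald8_biadjacency\<close>. With this numbering the sorted adjacency matrix has the
  off-diagonal block form that \<open>char_poly_bipartite\<close> expects.\<close>

definition bald8 :: "nat pair_pre_digraph" where
  "bald8 = \<lparr>pverts = {..<8},
     parcs = (let E = {(0,4), (0,5), (1,4), (1,5), (1,6), (2,6), (2,7), (3,4), (3,6), (3,7)}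
              in E \<union> E\<inverse>)\<rparr>"

lemma pverts_bald8: "pverts bald8 = {..<8}"
  by (simp add: bald8_def)

lemma pair_graph_bald8: "pair_graph bald8"
proof -
  have "parcs bald8 \<subseteq> {..<8} \<times> {..<8} - Id" "finite (parcs bald8)"
    by (auto simp: bald8_def Let_def)
  moreover have "sym (parcs bald8)"
    unfolding bald8_def Let_def by (simp only: pair_pre_digraph.simps sym_Un_converse)
  ultimately show ?thesis
    by unfold_locales
      (auto simp: pverts_bald8 symmetric_def arcs_ends_def arc_to_ends_def)
qed

lemma less8_iff: "i < 8 \<longleftrightarrow> i \<in> {0, 1, 2, 3, 4, 5, 6, 7}" for i :: nat
  by (simp add: numeral_eq_Suc less_Suc_eq disj_ac)

lemma bald_bald8: "bald bald8"
  unfolding bald_def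
proof
  fix v assume "v \<in> pverts bald8"
  then have v: "v \<in> {0, 1, 2, 3, 4, 5, 6, 7}"
    by (simp only: pverts_bald8 lessThan_iff less8_iff)
  \<comment> \<open>The two smallest neighbours of v, tabulated; two distinct out-arcs already
    exclude out-degree 1.\<close>
  define a :: nat where "a = [4,4,6,4,0,0,1,2] ! v"
  define b :: nat where "b = [5,5,7,6,1,1,2,3] ! v"
  have "a \<noteq> b" "(v, a) \<in> parcs bald8" "(v, b) \<in> parcs bald8"
    using v unfolding a_def b_def
    by (elim insertE emptyE; simp add: bald8_def)+
  then have "{(v, a), (v, b)} \<subseteq> out_arcs (with_proj bald8) v" "(v, a) \<noteq> (v, b)"
    by auto
  then show "out_degree (with_proj bald8) v \<noteq> 1"
    unfolding out_degree_def by (metis card_1_singletonE insert_subset singletonD)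
qed

lemma adjacency_matrix_bald8:
  "adjacency_matrix bald8
    = four_block_mat (0\<^sub>m 4 4) bald8_biadjacency (transpose_mat bald8_biadjacency) (0\<^sub>m 4 4)"
    (is "_ = ?R")
proof (rule eq_matI)
  fix i j assume "i < dim_row ?R" "j < dim_col ?R"
  then have "i < 8" "j < 8" by (simp_all add: bald8_biadjacency_def)
  then show "adjacency_matrix bald8 $$ (i, j) = ?R $$ (i, j)"
    unfolding adjacency_matrix_lessThan[OF pverts_bald8] less8_iff
    by (elim insertE emptyE; simp add: bald8_def bald8_biadjacency_def)
qed (simp_all add: adjacency_matrix_lessThan[OF pverts_bald8] bald8_biadjacency_def)

lemma char_poly_bald8_biadjacency:
  "char_poly (bald8_biadjacency * transpose_mat bald8_biadjacency) = [:1, -10, 23, -10, 1:]"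
proof -
  \<comment> \<open>The diagonal carries the degrees 2, 3, 2, 3 of the row vertices; the other
    entries are minus the numbers of common neighbours.\<close>
  let ?M = "mat 4 4 (\<lambda>(i, j).
       [[[:-2, 1:], [:-2:], 0, [:-1:]],
        [[:-2:], [:-3, 1:], [:-1:], [:-2:]],
        [0, [:-1:], [:-2, 1:], [:-2:]],
        [[:-1:], [:-2:], [:-2:], [:-3, 1:]]] ! i ! j) :: int poly mat"
  have "char_poly_matrix (bald8_biadjacency * transpose_mat bald8_biadjacency) = ?M"
  proof (rule eq_matI)
    fix i j assume "i < dim_row ?M" "j < dim_col ?M"
    then have "i \<in> {0, 1, 2, 3}" "j \<in> {0, 1, 2, 3}" by auto
    then show "char_poly_matrix (bald8_biadjacency * transpose_mat bald8_biadjacency) $$ (i, j)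
      = ?M $$ (i, j)"
      by (elim insertE emptyE; simp add: char_poly_matrix_def bald8_biadjacency_def scalar_prod_def
          sum.atLeast0_lessThan_Suc numeral_eq_Suc)
  qed (simp_all add: char_poly_matrix_def bald8_biadjacency_def)
  moreover have "det ?M = [:1, -10, 23, -10, 1:]"
    by (simp add: laplace_expansion_column[of _ 4 0] laplace_expansion_column[of _ 3 0]
      laplace_expansion_column[of _ 2 0] det_single cofactor_def mat_delete_def
      lessThan_nat_numeral)
  ultimately show ?thesis
    by (simp add: char_poly_def)
qed

lemma palindromic_bald8: "palindromic bald8"
proof -
  have "graph_char_poly bald8 = [:1, -10, 23, -10, 1:] \<circ>\<^sub>p monom 1 2"
    unfolding graph_char_poly_def adjacency_matrix_bald8 char_poly_bald8_biadjacency[symmetric]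
    by (rule char_poly_bipartite) simp_all
  \<comment> \<open>Putting x^2 for x only interleaves zeros, so the symmetry of 1, -10, 23, -10, 1
    is kept.\<close>
  also have "\<dots> = [:1, 0, -10, 0, 23, 0, -10, 0, 1:]"
    by (simp add: pcompose_pCons monom_altdef power2_eq_square)
  finally show ?thesis
    by (simp add: palindromic_iff_reflect_poly reflect_poly_def)
qed

theorem theorem3:
  fixes m :: nat
  assumes "m > 0"
  shows "\<exists>G :: nat pair_pre_digraph.
           pair_graph G \<and> card (pverts G) = 8 * m \<and> palindromic G \<and> bald G"
proof (intro exI conjI)
  let ?G = "disjoint_copies 8 m bald8"
  show "pair_graph ?G"
    by (rule pair_graph_disjoint_copies[OF pair_graph_bald8])
  show "card (pverts ?G) = 8 * m"
    by simp
  show "palindromic ?G"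
    using palindromic_bald8
    by (simp add: palindromic_iff_reflect_poly graph_char_poly_disjoint_copies pverts_bald8
        reflect_poly_power)
  show "bald ?G"
    by (rule bald_disjoint_copies[OF pverts_bald8 pair_graph_bald8 bald_bald8])
qed

end
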